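(* Let $\mathbb K$ be $\mathbb H$ or $\mathbb O$ and let $f:\mathbb R\times\mathbb S(-\pi,\pi)\to\mathbb K\times\mathbb R\cong\mathbb R^{\dim\mathbb K+1}$ be defined by $$f(x+Iy)=(\cosh x\cos y+I\cosh x\sin y,\ x)$$ for $x\in\mathbb R$, $y\in(-\pi,\pi)$, $I\in\mathbb S$. Then $f(\mathbb R\times\mathbb S(-\pi,\pi))$ is a parameterized hypercomplex Riemann manifold and $f$ is a slice isothermal parameterization.
   Context: $\mathbb K$ is the division algebra of quaternions $\mathbb H$ or octonions $\mathbb O$, identified with $\mathbb R^{\dim\mathbb K}$ ($\dim\mathbb K=4$ or $8$) with the Euclidean scalar product. $\mathbb S=\{I\in\mathbb K: I^2=-1\}$. $\mathbb R\times\mathbb S(-\pi,\pi)$ denotes $\{x+Iy: x\in\mathbb R,\ y\in(-\pi,\pi),\ I\in\mathbb S\}\subset\mathbb K$. For $I\in\mathbb S$, $\mathbb C_I=\mathbb R+I\mathbb R$ and $\mathbb C_I^\perp$ is its orthogonal complement in $\mathbb K$. A linear map $T$ from an $n$-dimensional Euclidean space to $\mathbb R^N$ is conformal if $T^tT=k\,\mathrm{Id}$ with $k\ne0$. A slice domain $\Omega\subseteq\mathbb K$ is an open connected set containing real points such that $\Omega\cap\mathbb C_I$ is a domain of $\mathbb C_I$ for each $I\in\mathbb S$. A $C^1$ map $f:\Omega\to\mathbb R^N$ ($N\ge\dim\mathbb K$) is slice conformal (slice isothermal) if for all $I\in\mathbb S$ and all $x+Iy\in\Omega$ both $df(x+Iy)_{|\mathbb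 C_I}$ and $df(x+Iy)_{|\mathbb C_I^\perp}$ are conformal. If $f$ is in addition an injective immersion, $f$ is a slice conformal (slice isothermal) parameterization and $f(\Omega)$ is a parameterized hypercomplex Riemann manifold of $\mathbb R^N$. *)

theory Defs
  imports "HOL-Analysis.Analysis"
begin

section \<open>Quaternions and octonions\<close>

text \<open>
  The Cayley--Dickson doubling of an algebra with conjugation. Doubling the complex numbers gives
  the quaternions, doubling the quaternions gives the octonions. Since octonion multiplication is
  not associative, the type classes for real algebras are not used; multiplication and unit are
  instances of the purely syntactic classes only.
\<close>

class conjugation =
  fixes conjugate :: "'a \<Rightarrow> 'a"

instantiation complex :: conjugation
begin
definition conj_complex_def: "conjugate = cnj"
instance ..
end

datatype 'a cd = CD (cd_fst: 'a) (cd_snd: 'a)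

type_synonym quat = "complex cd"
type_synonym octo = "quat cd"

text \<open>The Euclidean structure is that of the orthogonal sum of the two components.\<close>

instantiation cd :: (real_vector) real_vector
begin

definition zero_cd_def: "0 = CD 0 0"
definition plus_cd_def: "a + b = CD (cd_fst a + cd_fst b) (cd_snd a + cd_snd b)"
definition minus_cd_def: "a - b = CD (cd_fst a - cd_fst b) (cd_snd a - cd_snd b)"
definition uminus_cd_def: "- a = CD (- cd_fst a) (- cd_snd a)"
definition scaleR_cd_def: "r *\<^sub>R a = CD (r *\<^sub>R cd_fst a) (r *\<^sub>R cd_snd a)"

instance
  by standard (simp_all add: zero_cd_def plus_cd_def minus_cd_def uminus_cd_def scaleR_cd_def
    algebra_simps)

end

instantiation cd :: (real_inner) real_inner
begin

definition inner_cd_def: "inner a b = inner (cd_fst a) (cd_fst b) + inner (cd_snd a) (cd_snd b)"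
definition norm_cd_def: "norm (a :: 'a cd) = sqrt (inner a a)"
definition dist_cd_def: "dist (a :: 'a cd) b = norm (a - b)"
definition sgn_cd_def: "sgn (a :: 'a cd) = a /\<^sub>R norm a"
definition uniformity_cd_def [code del]:
  "(uniformity :: ('a cd \<times> 'a cd) filter) = (INF e\<in>{0<..}. principal {(x, y). dist x y < e})"
definition open_cd_def [code del]:
  "open (U :: 'a cd set) \<longleftrightarrow>
    (\<forall>x\<in>U. eventually (\<lambda>(x', y). x' = x \<longrightarrow> y \<in> U) uniformity)"

instance
proof
  fix a b c :: "'a cd" and r :: real and U :: "'a cd set"
  note defs = zero_cd_def plus_cd_def scaleR_cd_def inner_cd_def
  show "dist a b = norm (a - b)" "sgn a = a /\<^sub>R norm a" "norm a = sqrt (inner a a)"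
    by (simp_all add: dist_cd_def sgn_cd_def norm_cd_def)
  show "uniformity = (INF e\<in>{0<..}. principal {(x :: 'a cd, y). dist x y < e})"
    by (rule uniformity_cd_def)
  show "open U \<longleftrightarrow> (\<forall>x\<in>U. \<forall>\<^sub>F (x', y) in uniformity. x' = x \<longrightarrow> y \<in> U)"
    by (rule open_cd_def)
  show "inner a b = inner b a"
    by (simp add: defs inner_commute)
  show "inner (a + b) c = inner a c + inner b c"
    "inner (r *\<^sub>R a) b = r * inner a b" "0 \<le> inner a a"
    by (simp_all add: defs inner_add_left distrib_left)
  show "inner a a = 0 \<longleftrightarrow> a = 0"
    by (cases a) (simp add: defs add_nonneg_eq_0_iff)
qed

end

instantiation cd :: (euclidean_space) euclidean_space
begin

definition Basis_cd_def: "Basis = (\<lambda>u. CD u 0) ` Basis \<union> (\<lambda>v. CD 0 v) ` Basis"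

instance
proof
  show "(Basis :: 'a cd set) \<noteq> {}" "finite (Basis :: 'a cd set)"
    by (simp_all add: Basis_cd_def)
  fix u v :: "'a cd"
  assume "u \<in> Basis" "v \<in> Basis"
  thus "inner u v = (if u = v then 1 else 0)"
    by (auto simp: Basis_cd_def inner_cd_def inner_Basis split: if_split_asm)
next
  fix x :: "'a cd"
  show "(\<forall>u\<in>Basis. inner x u = 0) \<longleftrightarrow> x = 0"
    unfolding Basis_cd_def ball_Un ball_simps
    by (cases x) (simp add: inner_cd_def zero_cd_def euclidean_all_zero_iff)
qed

end

lemma DIM_cd: "DIM('a::euclidean_space cd) = 2 * DIM('a)"
proof -
  have "inj_on (\<lambda>u. CD (u::'a) 0) Basis" "inj_on (\<lambda>v. CD 0 (v::'a)) Basis"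
    by (auto intro: inj_onI)
  moreover have "(\<lambda>u. CD (u::'a) 0) ` Basis \<inter> (\<lambda>v. CD 0 v) ` Basis = {}"
    by auto
  ultimately show ?thesis
    unfolding Basis_cd_def by (subst card_Un_disjoint) (simp_all add: card_image)
qed

lemma DIM_quat: "DIM(quat) = 4" and DIM_octo: "DIM(octo) = 8"
  by (simp_all add: DIM_cd)

instantiation cd :: ("{zero, one}") one
begin
definition one_cd_def: "1 = CD 1 0"
instance ..
end

instantiation cd :: ("{conjugation, uminus}") conjugation
begin
definition conj_cd_def: "conjugate a = CD (conjugate (cd_fst a)) (- cd_snd a)"
instance ..
end

instantiation cd :: ("{conjugation, times, plus, minus}") times
begin
definition times_cd_def:
  "a * b = CD (cd_fst a * cd_fst b - conjugate (cd_snd b) * cd_snd a)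
              (cd_snd b * cd_fst a + cd_snd a * conjugate (cd_fst b))"
instance ..
end

lemmas cd_defs = zero_cd_def one_cd_def plus_cd_def minus_cd_def uminus_cd_def scaleR_cd_def
  inner_cd_def conj_cd_def times_cd_def conj_complex_def

text \<open>The multiplicative norm confirms that these are the division algebras in question.\<close>

lemma quat_mult_assoc: "(a * b) * c = a * (b * (c::quat))"
  by (simp add: cd_defs algebra_simps)

lemma quat_unit: "1 * a = a" "a * 1 = (a::quat)"
  and octo_unit: "1 * p = p" "p * 1 = (p::octo)"
  by (simp_all add: cd_defs)

lemma quat_norm_mult: "norm (a * b) = norm a * norm (b::quat)"
  by (simp add: norm_cd_def cd_defs inner_complex_def algebra_simps flip: real_sqrt_mult)

lemma octo_norm_mult: "norm (a * b) = norm a * norm (b::octo)"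
proof -
  obtain p q r s where ab: "a = CD p q" "b = CD r s"
    by (cases a, cases b)
  have add: "inner (u - v) (u - v) + inner (w + z) (w + z) =
      inner u u + inner v v + inner w w + inner z z - 2 * inner u v + 2 * inner w z"
    for u v w z :: quat
    by (simp add: inner_diff_left inner_diff_right inner_add_left inner_add_right inner_commute)
  have mult: "inner (u * v) (u * v) = inner u u * inner v v" for u v :: quat
    by (metis quat_norm_mult power2_norm_eq_inner power_mult_distrib)
  have conjugate: "inner (conjugate u) (conjugate u) = inner u u" for u :: quat
    by (simp add: cd_defs inner_complex_def)
  have "inner (p * r) (conjugate s * q) = inner p ((conjugate s * q) * conjugate r)"
    by (simp add: cd_defs inner_complex_def algebra_simps)
  also have "\<dots> = inner (s * p) (q * conjugate r)"
    unfolding quat_mult_assoc by (simp add: cd_defs inner_complex_def algebra_simps)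
  finally have cross: "inner (p * r) (conjugate s * q) = inner (s * p) (q * conjugate r)" .
  have "inner (a * b) (a * b) = inner a a * inner b b"
    unfolding ab times_cd_def[where 'a = quat] inner_cd_def[where 'a = quat] cd.sel
    by (simp add: add mult conjugate cross) (simp add: algebra_simps)
  thus ?thesis
    by (simp add: norm_cd_def real_sqrt_mult)
qed

section \<open>Slice domains and slice conformal maps\<close>

text \<open>
  The classes \<open>times\<close>, \<open>one\<close> in the definitions below are syntactic; they are only meant for
  \<open>quat\<close> and \<open>octo\<close>.
\<close>

definition imag_units :: "'a::{euclidean_space, times, one} set" where
  "imag_units = {I. I * I = - 1}"

text \<open>The point x + Iy.\<close>

definition slice_point :: "real \<Rightarrow> 'a::{euclidean_space, one} \<Rightarrow> real \<Rightarrow> 'a" where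
  "slice_point x I y = x *\<^sub>R 1 + y *\<^sub>R I"

definition slice_plane :: "'a::{euclidean_space, one} \<Rightarrow> 'a set" where
  "slice_plane I = {slice_point x I y | x y. True}"

definition slice_strip :: "real set \<Rightarrow> real set \<Rightarrow> 'a::{euclidean_space, times, one} set" where
  "slice_strip A B = {slice_point x I y | x y I. x \<in> A \<and> y \<in> B \<and> I \<in> imag_units}"

definition slice_domain :: "'a::{euclidean_space, times, one} set \<Rightarrow> bool" where
  "slice_domain \<Omega> \<longleftrightarrow>
     open \<Omega> \<and> connected \<Omega> \<and> (\<exists>x::real. x *\<^sub>R 1 \<in> \<Omega>) \<and>
     (\<forall>I\<in>imag_units. \<Omega> \<inter> slice_plane I \<noteq> {} \<and> connected (\<Omega> \<inter> slice_plane I) \<and>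
        openin (top_of_set (slice_plane I)) (\<Omega> \<inter> slice_plane I))"

text \<open>
  Conformality of the restriction of a linear map \<open>T\<close> to a subspace \<open>V\<close>: the map \<open>T'\<close> is the
  transpose (adjoint) of the restriction, which goes from the whole target space back to \<open>V\<close>.
\<close>

definition conformal_on ::
    "'a::euclidean_space set \<Rightarrow> ('a \<Rightarrow> 'b::euclidean_space) \<Rightarrow> bool" where
  "conformal_on V T \<longleftrightarrow> subspace V \<and> linear T \<and>
     (\<exists>T' k. (\<forall>w. T' w \<in> V) \<and> (\<forall>v\<in>V. \<forall>w. inner (T v) w = inner v (T' w)) \<and>
             k \<noteq> 0 \<and> (\<forall>v\<in>V. T' (T v) = k *\<^sub>R v))"

definition C1_on :: "'a::euclidean_space set \<Rightarrow> ('a \<Rightarrow> 'b::euclidean_space) \<Rightarrow> bool" where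
  "C1_on \<Omega> f \<longleftrightarrow>
     (\<exists>f' :: 'a \<Rightarrow> 'a \<Rightarrow>\<^sub>L 'b.
        (\<forall>p\<in>\<Omega>. (f has_derivative blinfun_apply (f' p)) (at p)) \<and> continuous_on \<Omega> f')"

definition slice_conformal ::
    "'a::{euclidean_space, times, one} set \<Rightarrow> ('a \<Rightarrow> 'b::euclidean_space) \<Rightarrow> bool" where
  "slice_conformal \<Omega> f \<longleftrightarrow>
     DIM('a) \<le> DIM('b) \<and> slice_domain \<Omega> \<and> C1_on \<Omega> f \<and>
     (\<forall>I\<in>imag_units. \<forall>x y. slice_point x I y \<in> \<Omega> \<longrightarrow>
        conformal_on (slice_plane I) (frechet_derivative f (at (slice_point x I y))) \<and>
        conformal_on (orthogonal_comp (slice_plane I))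
          (frechet_derivative f (at (slice_point x I y))))"

text \<open>``Slice isothermal'' is synonymous with ``slice conformal''.\<close>

definition slice_isothermal_parameterization ::
    "'a::{euclidean_space, times, one} set \<Rightarrow> ('a \<Rightarrow> 'b::euclidean_space) \<Rightarrow> bool" where
  "slice_isothermal_parameterization \<Omega> f \<longleftrightarrow>
     slice_conformal \<Omega> f \<and> inj_on f \<Omega> \<and> (\<forall>p\<in>\<Omega>. inj (frechet_derivative f (at p)))"

text \<open>The type argument is the algebra over which the manifold is parameterized.\<close>

definition parameterized_hypercomplex_manifold ::
    "'a::{euclidean_space, times, one} itself \<Rightarrow> 'b::euclidean_space set \<Rightarrow> bool" where
  "parameterized_hypercomplex_manifold _ M \<longleftrightarrow>
     (\<exists>(\<Omega> :: 'a set) f. slice_isothermal_parameterization \<Omega> f \<and> M = f ` \<Omega>)"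

section \<open>Maps given by a formula in slice coordinates\<close>

text \<open>
  The representation x + Iy of a point is not unique. The following shows that the formula
  (cosh x cos y + I cosh x sin y, x) nevertheless defines a map, for both algebras.
\<close>

lemma imag_units_quat:
  assumes "I \<in> (imag_units :: quat set)"
  shows "inner I 1 = 0" "norm I = 1"
proof -
  have sq: "I * I = - 1"
    using assms by (simp add: imag_units_def)
  have "norm I * norm I = 1"
    by (simp flip: quat_norm_mult add: sq) (simp add: norm_cd_def cd_defs)
  thus norm: "norm I = 1"
    by (metis norm_ge_zero abs_of_nonneg real_sqrt_abs2 real_sqrt_one)
  have "I * I = (2 * inner I 1) *\<^sub>R I - (norm I)\<^sup>2 *\<^sub>R 1"
    by (cases I) (simp add: power2_norm_eq_inner cd_defs inner_complex_def complex_eq_iff algebra_simps)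
  hence "(2 * inner I 1) *\<^sub>R I = 0"
    by (simp add: sq norm)
  thus "inner I 1 = 0"
    using norm by auto
qed

lemma imag_units_octo:
  assumes "I \<in> (imag_units :: octo set)"
  shows "inner I 1 = 0" "norm I = 1"
proof -
  have sq: "I * I = - 1"
    using assms by (simp add: imag_units_def)
  have "norm I * norm I = 1"
    by (simp flip: octo_norm_mult add: sq) (simp add: norm_cd_def cd_defs)
  thus norm: "norm I = 1"
    by (metis norm_ge_zero abs_of_nonneg real_sqrt_abs2 real_sqrt_one)
  have "I * I = (2 * inner I 1) *\<^sub>R I - (norm I)\<^sup>2 *\<^sub>R 1"
    by (cases I) (simp add: power2_norm_eq_inner cd_defs inner_complex_def complex_eq_iff algebra_simps)
  hence "(2 * inner I 1) *\<^sub>R I = 0"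
    by (simp add: sq norm)
  thus "inner I 1 = 0"
    using norm by auto
qed

lemma slice_formula_well_defined:
  fixes S :: "'a::{euclidean_space, one} set"
  assumes S: "\<And>I. I \<in> S \<Longrightarrow> inner I 1 = 0 \<and> norm I = 1" and one: "norm (1::'a) = 1"
  shows "\<exists>f :: 'a \<Rightarrow> 'a \<times> real. \<forall>x y. \<forall>I\<in>S.
           f (slice_point x I y) = (slice_point (cosh x * cos y) I (cosh x * sin y), x)"
proof -
  let ?g = "\<lambda>x I y. (slice_point (cosh x * cos y) I (cosh x * sin y), x) :: 'a \<times> real"
  have uniq: "?g x I y = ?g x' I' y'"
    if I: "I \<in> S" "I' \<in> S" and eq: "slice_point x I y = slice_point x' I' y'" for x y x' y' I I'
  proof -
    have "inner (slice_point x I y) 1 = inner (slice_point x' I' y') 1"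
      by (simp add: eq)
    hence x: "x = x'"
      using S[OF I(1)] S[OF I(2)] one
      by (simp add: slice_point_def inner_add_left power2_norm_eq_inner[symmetric])
    hence yI: "y *\<^sub>R I = y' *\<^sub>R I'"
      using eq by (simp add: slice_point_def)
    hence "\<bar>y\<bar> = \<bar>y'\<bar>"
      using S[OF I(1)] S[OF I(2)] by (metis mult.right_neutral norm_scaleR)
    then consider "y = y'" | "y = - y'"
      by linarith
    hence "cos y = cos y' \<and> sin y *\<^sub>R I = sin y' *\<^sub>R I'"
    proof cases
      case 1
      thus ?thesis using yI by (cases "y = 0") auto
    next
      case 2
      hence "y' *\<^sub>R I' = - (y' *\<^sub>R I)"
        using yI by simp
      hence "y' *\<^sub>R (I + I') = 0"
        by (simp add: scaleR_add_right)
      thus ?thesis using 2 by (auto simp: add_eq_0_iff)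
    qed
    thus ?thesis
      using x by (simp add: slice_point_def flip: scaleR_scaleR)
  qed
  define f where "f p = (SOME v. \<exists>x y. \<exists>I\<in>S. p = slice_point x I y \<and> v = ?g x I y)" for p
  have "f (slice_point x I y) = ?g x I y" if "I \<in> S" for x y I
    unfolding f_def
  proof (rule some_equality)
    show "\<exists>x' y'. \<exists>I'\<in>S. slice_point x I y = slice_point x' I' y' \<and> ?g x I y = ?g x' I' y'"
      using that by blast
  next
    fix v
    assume "\<exists>x' y'. \<exists>I'\<in>S. slice_point x I y = slice_point x' I' y' \<and> v = ?g x' I' y'"
    then obtain x' y' I' where *: "I' \<in> S" "slice_point x I y = slice_point x' I' y'"
      and "v = ?g x' I' y'"
      by blast
    thus "v = ?g x I y"
      using uniq[OF that *] by metis
  qed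
  thus ?thesis
    by blast
qed

lemma slice_formula_quat:
  "\<exists>f :: quat \<Rightarrow> quat \<times> real. \<forall>x y. \<forall>I\<in>imag_units.
     f (slice_point x I y) = (slice_point (cosh x * cos y) I (cosh x * sin y), x)"
  by (rule slice_formula_well_defined) (auto dest: imag_units_quat simp: norm_cd_def cd_defs)

lemma slice_formula_octo:
  "\<exists>f :: octo \<Rightarrow> octo \<times> real. \<forall>x y. \<forall>I\<in>imag_units.
     f (slice_point x I y) = (slice_point (cosh x * cos y) I (cosh x * sin y), x)"
  by (rule slice_formula_well_defined) (auto dest: imag_units_octo simp: norm_cd_def cd_defs)

end

theory Submission
  imports Defs
begin

text \<open>
  Write \<open>p = x + v\<close> with \<open>x\<close> real and \<open>v\<close> orthogonal to 1. Since the cosine and the cardinal sine are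
  even, they are entire functions \<open>C\<close>, \<open>s\<close> of the square of their argument, so that
  \<open>f p = (cosh x C(v\<^sup>2) + cosh x s(v\<^sup>2) v, x)\<close> is smooth also across the real axis. The derivative at
  \<open>x + Iy\<close> maps the plane \<open>\<complex>\<^sub>I\<close> as that of a catenoid chart, with
  dilation factor \<open>cosh x\<close>, and is multiplication by \<open>cosh x sin y / y\<close> on the orthogonal complement.
  The two images are orthogonal, which gives the immersion property.
\<close>

section \<open>Cosine and cardinal sine as functions of the square\<close>

text \<open>The termwise derived series again converges everywhere, so it is itself differentiable
  and hence continuous. Phrasing the result with \<open>deriv\<close> keeps the coefficients
  \<open>diffs c\<close> out of everything that follows.\<close>

lemma powser_everywhere_deriv:
  fixes c :: "nat \<Rightarrow> real"
  assumes "\<And>t. summable (\<lambda>n. c n * t ^ n)"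
  shows "((\<lambda>t. \<Sum>n. c n * t ^ n) has_field_derivative deriv (\<lambda>t. \<Sum>n. c n * t ^ n) t) (at t)"
    and "continuous_on UNIV (deriv (\<lambda>t. \<Sum>n. c n * t ^ n))"
proof -
  have D: "((\<lambda>t. \<Sum>n. c n * t ^ n) has_field_derivative (\<Sum>n. diffs c n * t ^ n)) (at t)" for t
    by (rule termdiffs_strong_converges_everywhere[OF assms])
  hence eq: "deriv (\<lambda>t. \<Sum>n. c n * t ^ n) = (\<lambda>t. \<Sum>n. diffs c n * t ^ n)"
    by (intro ext DERIV_imp_deriv)
  show "((\<lambda>t. \<Sum>n. c n * t ^ n) has_field_derivative deriv (\<lambda>t. \<Sum>n. c n * t ^ n) t) (at t)"
    using D by (simp add: eq)
  have "summable (\<lambda>n. diffs c n * t ^ n)" for t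
    by (rule termdiff_converges_all[OF assms])
  hence "((\<lambda>t. \<Sum>n. diffs c n * t ^ n) has_field_derivative (\<Sum>n. diffs (diffs c) n * t ^ n)) (at t)" for t
    by (rule termdiffs_strong_converges_everywhere)
  thus "continuous_on UNIV (deriv (\<lambda>t. \<Sum>n. c n * t ^ n))"
    unfolding eq by (intro continuous_at_imp_continuous_on ballI DERIV_isCont)
qed

text \<open>The positive number \<open>\<bar>t\<bar> + 1\<close> is the square of a nonzero real,
  and convergence there gives convergence at every point of smaller modulus, negative ones
  included.\<close>

lemma summable_powser_if_squares:
  fixes c :: "nat \<Rightarrow> real"
  assumes "\<And>y. y \<noteq> 0 \<Longrightarrow> summable (\<lambda>n. c n * (y\<^sup>2) ^ n)"
  shows "summable (\<lambda>n. c n * t ^ n)"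
proof (rule powser_inside)
  show "summable (\<lambda>n. c n * (\<bar>t\<bar> + 1) ^ n)"
    using assms[of "sqrt (\<bar>t\<bar> + 1)"] by simp
qed simp

text \<open>For t \<ge> 0 this is the cosine of the square root of t. The series makes it smooth at
  0, which corresponds to the real axis and where the square root is not differentiable.\<close>

definition cos_sqrt :: "real \<Rightarrow> real" where
  "cos_sqrt t = (\<Sum>n. (- 1) ^ n / fact (2 * n) * t ^ n)"

text \<open>The entire function that equals \<open>sin y / y\<close> at t = \<open>y\<^sup>2\<close>
  for nonzero y.\<close>

definition sinc_sqrt :: "real \<Rightarrow> real" where
  "sinc_sqrt t = (\<Sum>n. (- 1) ^ n / fact (2 * n + 1) * t ^ n)"

lemma cos_sqrt_sums: "(\<lambda>n. (- 1) ^ n / fact (2 * n) * (y\<^sup>2) ^ n) sums cos (y :: real)"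
  using cos_paired[of y] by (simp add: power_mult)

lemma cos_sqrt_square: "cos_sqrt (y\<^sup>2) = cos y"
  using cos_sqrt_sums by (simp add: cos_sqrt_def sums_iff)

lemma sinc_sqrt_sums:
  assumes "y \<noteq> (0 :: real)"
  shows "(\<lambda>n. (- 1) ^ n / fact (2 * n + 1) * (y\<^sup>2) ^ n) sums (sin y / y)"
  using sums_divide[OF sin_paired[of y], of y] assms by (simp add: power_mult)

lemma sinc_sqrt_square: "sinc_sqrt (y\<^sup>2) * y = sin y"
  using sinc_sqrt_sums[of y] by (cases "y = 0") (auto simp add: sinc_sqrt_def sums_iff)

lemma sinc_sqrt_0: "sinc_sqrt 0 = 1"
  using powser_zero[of "\<lambda>n. (- 1) ^ n / fact (2 * n + 1) :: real"] by (simp add: sinc_sqrt_def)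

lemma cos_sqrt_DERIV: "(cos_sqrt has_field_derivative deriv cos_sqrt t) (at t)"
  and continuous_deriv_cos_sqrt: "continuous_on UNIV (deriv cos_sqrt)"
proof -
  have "summable (\<lambda>n. (- 1) ^ n / fact (2 * n) * t ^ n :: real)" for t
    by (rule summable_powser_if_squares) (rule sums_summable[OF cos_sqrt_sums])
  note * = powser_everywhere_deriv[OF this, folded cos_sqrt_def]
  show "(cos_sqrt has_field_derivative deriv cos_sqrt t) (at t)"
    "continuous_on UNIV (deriv cos_sqrt)"
    by (rule *)+
qed

lemma sinc_sqrt_DERIV: "(sinc_sqrt has_field_derivative deriv sinc_sqrt t) (at t)"
  and continuous_deriv_sinc_sqrt: "continuous_on UNIV (deriv sinc_sqrt)"
proof -
  have "summable (\<lambda>n. (- 1) ^ n / fact (2 * n + 1) * t ^ n :: real)" for t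
    by (rule summable_powser_if_squares) (rule sums_summable[OF sinc_sqrt_sums])
  note * = powser_everywhere_deriv[OF this, folded sinc_sqrt_def]
  show "(sinc_sqrt has_field_derivative deriv sinc_sqrt t) (at t)"
    "continuous_on UNIV (deriv sinc_sqrt)"
    by (rule *)+
qed

lemma continuous_cos_sqrt: "continuous_on UNIV cos_sqrt"
  and continuous_sinc_sqrt: "continuous_on UNIV sinc_sqrt"
  by (auto intro!: continuous_at_imp_continuous_on DERIV_isCont cos_sqrt_DERIV sinc_sqrt_DERIV)

text \<open>Both sides are the derivative of \<open>cos_sqrt (y\<^sup>2)\<close>, by the chain rule
  and as the derivative of the cosine.\<close>

lemma deriv_cos_sqrt_square: "deriv cos_sqrt (y\<^sup>2) * (2 * y) = - sin y"
proof -
  have "((\<lambda>y. cos_sqrt (y\<^sup>2)) has_field_derivative deriv cos_sqrt (y\<^sup>2) * (2 * y)) (at y)"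
    by (rule DERIV_chain2[OF cos_sqrt_DERIV]) (auto intro!: derivative_eq_intros)
  moreover have "((\<lambda>y. cos_sqrt (y\<^sup>2)) has_field_derivative - sin y) (at y)"
    by (simp add: cos_sqrt_square DERIV_cos)
  ultimately show ?thesis
    by (rule DERIV_unique)
qed

text \<open>The same comparison for \<open>sinc_sqrt (y\<^sup>2) * y\<close>, which is the sine. The
  left side is the combination that appears as coefficient of I in the derivative along a
  slice.\<close>

lemma deriv_sinc_sqrt_square: "deriv sinc_sqrt (y\<^sup>2) * (2 * y\<^sup>2) + sinc_sqrt (y\<^sup>2) = cos y"
proof -
  have "((\<lambda>y. sinc_sqrt (y\<^sup>2)) has_field_derivative deriv sinc_sqrt (y\<^sup>2) * (2 * y)) (at y)"
    by (rule DERIV_chain2[OF sinc_sqrt_DERIV]) (auto intro!: derivative_eq_intros)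
  hence "((\<lambda>y. sinc_sqrt (y\<^sup>2) * y) has_field_derivative
      deriv sinc_sqrt (y\<^sup>2) * (2 * y) * y + 1 * sinc_sqrt (y\<^sup>2)) (at y)"
    by (rule DERIV_mult) simp
  moreover have "((\<lambda>y. sinc_sqrt (y\<^sup>2) * y) has_field_derivative cos y) (at y)"
    by (simp add: sinc_sqrt_square DERIV_sin)
  ultimately have "deriv sinc_sqrt (y\<^sup>2) * (2 * y) * y + 1 * sinc_sqrt (y\<^sup>2) = cos y"
    by (rule DERIV_unique)
  thus ?thesis
    by (simp add: power2_eq_square mult.assoc)
qed

text \<open>This is where the width of the strip enters: the cardinal sine has its first zeros at pi
  and -pi.\<close>

lemma sinc_sqrt_nonzero:
  assumes "\<bar>y\<bar> < pi"
  shows "sinc_sqrt (y\<^sup>2) \<noteq> 0"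
proof (cases "y = 0")
  case True
  thus ?thesis by (simp add: sinc_sqrt_0)
next
  case False
  hence "sin y \<noteq> 0"
    using assms sin_gt_zero[of y] sin_gt_zero[of "- y"] by (cases "y > 0") auto
  thus ?thesis
    using sinc_sqrt_square[of y] by auto
qed

section \<open>Conformality on a subspace\<close>

text \<open>Replaces the transpose in the definition by a condition on inner products. The transpose
  of the restriction is the full adjoint followed by orthogonal projection onto V.\<close>

lemma conformal_onI:
  fixes T :: "'a::euclidean_space \<Rightarrow> 'b::euclidean_space"
  assumes V: "subspace V" and T: "linear T" and k: "k \<noteq> 0"
    and inner: "\<And>u v. u \<in> V \<Longrightarrow> v \<in> V \<Longrightarrow> inner (T u) (T v) = k * inner u v"
  shows "conformal_on V T"
proof -
  have "\<exists>u\<in>V. \<forall>v\<in>V. inner (T v) w = inner v u" for w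
  proof -
    obtain u z where u: "u \<in> span V" and z: "\<And>v. v \<in> span V \<Longrightarrow> orthogonal z v"
      and eq: "adjoint T w = u + z"
      using orthogonal_subspace_decomp_exists by metis
    have "inner (T v) w = inner v u" if "v \<in> V" for v
    proof -
      have "inner (T v) w = inner v (u + z)"
        using adjoint_works[OF T, of v w] eq by simp
      thus ?thesis
        using z[OF span_base[OF that]] by (simp add: inner_add_right orthogonal_def inner_commute)
    qed
    thus ?thesis
      using u V by (metis span_eq_iff)
  qed
  then obtain T' where T': "\<And>w. T' w \<in> V" "\<And>v w. v \<in> V \<Longrightarrow> inner (T v) w = inner v (T' w)"
    by metis
  have "T' (T v) = k *\<^sub>R v" if v: "v \<in> V" for v
  proof -
    \<comment> \<open>The difference lies in V, so it may be tested against itself; the hypothesis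
      on inner products then makes its norm vanish.\<close>
    let ?d = "T' (T v) - k *\<^sub>R v"
    have d: "?d \<in> V"
      using V T'(1) v by (intro subspace_diff subspace_scale)
    have "inner ?d ?d = inner (T ?d) (T v) - k * inner ?d v"
      by (simp add: T'(2)[OF d] inner_diff_right)
    thus ?thesis
      using inner[OF d v] by simp
  qed
  thus ?thesis
    unfolding conformal_on_def using V T T' k by blast
qed

section \<open>Slice planes and the strip\<close>

text \<open>Expressed by the inner product instead of conjugation, so that one argument, free of
  multiplication, covers both algebras.\<close>

definition im_part :: "'a::{euclidean_space, one} \<Rightarrow> 'a" where
  "im_part p = p - inner p 1 *\<^sub>R 1"

lemma im_part_decomp: "p = inner p 1 *\<^sub>R 1 + im_part p"
  by (simp add: im_part_def)

lemma bounded_linear_im_part: "bounded_linear (im_part :: 'a::{euclidean_space, one} \<Rightarrow> 'a)"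
  unfolding im_part_def
  by (intro bounded_linear_sub bounded_linear_ident bounded_linear_scaleR_const
      bounded_linear_inner_left)

lemma inner_im_part_one:
  assumes "norm (1::'a::{euclidean_space, one}) = 1"
  shows "inner (im_part (p::'a)) 1 = 0"
  using assms by (simp add: im_part_def inner_diff_left norm_eq_1)

lemma slice_point_coords:
  fixes I :: "'a::{euclidean_space, one}"
  assumes "norm (1::'a) = 1" "inner I 1 = 0"
  shows "inner (slice_point x I y) 1 = x" "im_part (slice_point x I y) = y *\<^sub>R I"
  using assms by (simp_all add: slice_point_def im_part_def inner_add_left norm_eq_1)

lemma subspace_slice_plane: "subspace (slice_plane I)"
proof (rule subspaceI)
  show "0 \<in> slice_plane I"
    by (auto simp: slice_plane_def slice_point_def intro!: exI[of _ 0])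
next
  fix u v
  assume "u \<in> slice_plane I" "v \<in> slice_plane I"
  then obtain a b a' b' where "u = slice_point a I b" "v = slice_point a' I b'"
    unfolding slice_plane_def by blast
  hence "u + v = slice_point (a + a') I (b + b')"
    by (simp add: slice_point_def scaleR_add_left)
  thus "u + v \<in> slice_plane I"
    unfolding slice_plane_def by blast
next
  fix u and c :: real
  assume "u \<in> slice_plane I"
  then obtain a b where "u = slice_point a I b"
    unfolding slice_plane_def by blast
  hence "c *\<^sub>R u = slice_point (c * a) I (c * b)"
    by (simp add: slice_point_def scaleR_add_right)
  thus "c *\<^sub>R u \<in> slice_plane I"
    unfolding slice_plane_def by blast
qed

lemma orthogonal_slice_plane:
  assumes "w \<in> orthogonal_comp (slice_plane I)"
  shows "inner w 1 = 0" "inner w I = 0"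
proof -
  have "slice_point 1 I 0 \<in> slice_plane I" "slice_point 0 I 1 \<in> slice_plane I"
    unfolding slice_plane_def by blast+
  thus "inner w 1 = 0" "inner w I = 0"
    using assms by (auto simp: orthogonal_comp_def orthogonal_def slice_point_def inner_commute)
qed

text \<open>A description of the strip that avoids the ambiguous coordinates: the imaginary part of
  x + Iy has norm \<bar>y\<bar>, and conversely I can be taken as the normalized imaginary part and
  y as its norm.\<close>

lemma slice_strip_eq:
  assumes one: "norm (1::'a::{euclidean_space, times, one}) = 1"
    and units: "imag_units = {I::'a. inner I 1 = 0 \<and> norm I = 1}"
    and ne: "(imag_units :: 'a set) \<noteq> {}"
  shows "slice_strip UNIV {- r<..<r} = {p::'a. norm (im_part p) < r}"
proof (intro set_eqI iffI)
  fix p :: 'a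
  assume "p \<in> slice_strip UNIV {- r<..<r}"
  thus "p \<in> {p. norm (im_part p) < r}"
    by (auto simp: slice_strip_def units slice_point_coords[OF one])
next
  fix p :: 'a
  assume p: "p \<in> {p. norm (im_part p) < r}"
  obtain I where I: "I \<in> imag_units" "im_part p = norm (im_part p) *\<^sub>R I"
  proof (cases "im_part p = 0")
    case True
    \<comment> \<open>At a real point every imaginary unit serves, so it is enough that one
      exists.\<close>
    thus ?thesis using ne that by auto
  next
    case False
    thus ?thesis
      using that[of "im_part p /\<^sub>R norm (im_part p)"] by (simp add: units inner_im_part_one[OF one])
  qed
  have "p = slice_point (inner p 1) I (norm (im_part p))"
    using im_part_decomp[of p] I(2) by (simp add: slice_point_def)
  moreover have "norm (im_part p) \<in> {- r<..<r}"
    using p norm_ge_zero[of "im_part p"] by (simp del: norm_ge_zero)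
  ultimately show "p \<in> slice_strip UNIV {- r<..<r}"
    using I(1) unfolding slice_strip_def by blast
qed

text \<open>The set is the preimage of a ball under a linear map, hence open and convex; its
  intersection with a slice plane is then convex as well, and contains 0.\<close>

lemma slice_domain_strip:
  fixes r :: real
  assumes one: "norm (1::'a::{euclidean_space, times, one}) = 1" and r: "r > 0"
  shows "slice_domain {p::'a. norm (im_part p) < r}" (is "slice_domain ?\<Omega>")
proof -
  have "open (im_part -` ball (0::'a) r)"
    by (intro open_vimage open_ball linear_continuous_on bounded_linear_im_part)
  moreover have "?\<Omega> = im_part -` ball 0 r"
    by auto
  ultimately have op: "open ?\<Omega>"
    by simp
  have cv: "convex ?\<Omega>"
    using convex_linear_vimage[OF bounded_linear.linear[OF bounded_linear_im_part] convex_ball, of "0::'a" r]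
    \<open>?\<Omega> = _\<close> by simp
  have 0: "0 *\<^sub>R 1 \<in> ?\<Omega>"
    using r by (simp add: im_part_def)
  have "?\<Omega> \<inter> slice_plane I \<noteq> {}" for I :: 'a
    using 0 subspace_0[OF subspace_slice_plane, of I] by auto
  moreover have "connected (?\<Omega> \<inter> slice_plane I)" for I :: 'a
    by (intro convex_connected convex_Int cv subspace_imp_convex subspace_slice_plane)
  moreover have "openin (top_of_set (slice_plane I)) (?\<Omega> \<inter> slice_plane I)" for I :: 'a
    using openin_open_Int[OF op, of "slice_plane I"] by (simp add: Int_commute)
  ultimately show ?thesis
    unfolding slice_domain_def using op convex_connected[OF cv] 0 by blast
qed

section \<open>The map and its derivative\<close>

text \<open>The map written without choosing I and y: at x + Iy the imaginary part is Iy and its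
  squared norm is \<open>y\<^sup>2\<close>.\<close>

definition catenoid :: "'a::{euclidean_space, one} \<Rightarrow> 'a \<times> real" where
  "catenoid p =
     ((cosh (inner p 1) * cos_sqrt (inner (im_part p) (im_part p))) *\<^sub>R 1 +
      (cosh (inner p 1) * sinc_sqrt (inner (im_part p) (im_part p))) *\<^sub>R im_part p, inner p 1)"

text \<open>The product and chain rules applied to \<open>catenoid\<close>;
  \<open>2 * inner v w\<close> is the differential of the squared norm of the imaginary
  part.\<close>

definition catenoid_deriv :: "'a::{euclidean_space, one} \<Rightarrow> 'a \<Rightarrow> 'a \<times> real" where
  "catenoid_deriv p h =
     (let x = inner p 1; v = im_part p; q = inner v v; a = inner h 1; w = im_part h in
       ((sinh x * a * cos_sqrt q + cosh x * (deriv cos_sqrt q * (2 * inner v w))) *\<^sub>R 1 +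
        (sinh x * a * sinc_sqrt q + cosh x * (deriv sinc_sqrt q * (2 * inner v w))) *\<^sub>R v +
        (cosh x * sinc_sqrt q) *\<^sub>R w, a))"

lemma catenoid_slice_point:
  fixes I :: "'a::{euclidean_space, one}"
  assumes "norm (1::'a) = 1" "inner I 1 = 0" "norm I = 1"
  shows "catenoid (slice_point x I y) = (slice_point (cosh x * cos y) I (cosh x * sin y), x)"
proof -
  have "inner (y *\<^sub>R I) (y *\<^sub>R I) = y\<^sup>2"
    using assms(3) by (simp add: norm_eq_1 power2_eq_square)
  thus ?thesis
    using sinc_sqrt_square[of y] cos_sqrt_square[of y]
    by (simp add: catenoid_def slice_point_coords[OF assms(1,2)])
      (simp add: slice_point_def mult.assoc)
qed

lemma has_derivative_catenoid: "(catenoid has_derivative catenoid_deriv p) (at p)"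
proof -
  note im = bounded_linear_imp_has_derivative[OF bounded_linear_im_part]
  have q: "((\<lambda>p. inner (im_part p) (im_part p)) has_derivative
      (\<lambda>h. 2 * inner (im_part p) (im_part h))) (at p)"
    by (rule has_derivative_eq_rhs[OF has_derivative_inner[OF im im]]) (simp add: inner_commute)
  note comp = DERIV_compose_FDERIV
  note C = comp[OF cos_sqrt_DERIV q] and s = comp[OF sinc_sqrt_DERIV q]
  have x: "((\<lambda>p. inner p 1) has_derivative (\<lambda>h. inner h 1)) (at p)"
    by (rule bounded_linear_imp_has_derivative[OF bounded_linear_inner_left])
  have "(cosh has_field_derivative sinh (inner p 1)) (at (inner p 1))"
    by (auto intro!: derivative_eq_intros)
  note c = comp[OF this x]
  show ?thesis
    unfolding catenoid_def[abs_def]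
    by (rule has_derivative_eq_rhs[OF has_derivative_Pair[OF has_derivative_add
        [OF has_derivative_scaleR[OF has_derivative_mult[OF c C] has_derivative_const]
            has_derivative_scaleR[OF has_derivative_mult[OF c s] im]] x]])
      (auto simp: catenoid_deriv_def Let_def algebra_simps fun_eq_iff)
qed

lemma C1_on_catenoid: "C1_on \<Omega> (catenoid :: 'a::{euclidean_space, one} \<Rightarrow> _)"
proof -
  have D: "blinfun_apply (Blinfun (catenoid_deriv p)) = catenoid_deriv p" for p :: 'a
    using has_derivative_bounded_linear[OF has_derivative_catenoid] by (rule bounded_linear_Blinfun_apply)
  note cont = continuous_cos_sqrt continuous_sinc_sqrt continuous_deriv_cos_sqrt
    continuous_deriv_sinc_sqrt
  note cont' = cont[THEN continuous_on_compose2]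
  \<comment> \<open>In finite dimension, continuity of the operator-valued derivative can be checked
    for each fixed direction \<open>h\<close>.\<close>
  have "continuous_on \<Omega> (\<lambda>p. catenoid_deriv p h)" for h :: 'a
    unfolding catenoid_deriv_def Let_def
    by (intro continuous_intros cont'[where f = "\<lambda>p. inner (im_part p) (im_part p)"]
        linear_continuous_on bounded_linear_im_part subset_UNIV)
  hence "continuous_on \<Omega> (\<lambda>p. Blinfun (catenoid_deriv p))"
    by (intro continuous_on_blinfun_componentwise) (simp add: D)
  thus ?thesis
    unfolding C1_on_def
    by (intro exI[of _ "\<lambda>p. Blinfun (catenoid_deriv p)"]) (simp add: D has_derivative_catenoid)
qed

section \<open>The pulled-back metric, conformality and injectivity\<close>

text \<open>The central computation: every direction is split into a part in the slice plane and a
  part \<open>w\<close> orthogonal to it. The right side has no mixed terms, so the images of the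
  two parts are orthogonal, and the two dilation factors can be read off.\<close>

lemma inner_catenoid_deriv:
  fixes I :: "'a::{euclidean_space, one}"
  assumes one: "norm (1::'a) = 1" and I: "inner I 1 = 0" "norm I = 1"
    and w: "inner w 1 = 0" "inner w I = 0" and w': "inner w' 1 = 0" "inner w' I = 0"
  shows "inner (catenoid_deriv (slice_point x I y) (slice_point a I b + w))
               (catenoid_deriv (slice_point x I y) (slice_point a' I b' + w')) =
         (cosh x)\<^sup>2 * (a * a' + b * b') + (cosh x * sinc_sqrt (y\<^sup>2))\<^sup>2 * inner w w'"
proof -
  have q: "inner (y *\<^sub>R I) (y *\<^sub>R I) = y\<^sup>2" "inner I I = 1" "inner (1::'a) 1 = 1"
    using one I(2) by (simp_all add: norm_eq_1 power2_eq_square)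
  \<comment> \<open>Here \<open>a\<close> and \<open>b\<close> multiply the partial derivatives in x
    and y of the catenoid chart (cosh x cos y, cosh x sin y, x), while \<open>w\<close> is only
    scaled.\<close>
  have D: "catenoid_deriv (slice_point x I y) (slice_point a I b + w) =
      ((a * sinh x * cos y - b * cosh x * sin y) *\<^sub>R 1 +
       (a * sinh x * sin y + b * cosh x * cos y) *\<^sub>R I + (cosh x * sinc_sqrt (y\<^sup>2)) *\<^sub>R w, a)"
    if w: "inner w 1 = 0" "inner w I = 0" for a b w
  proof -
    have h: "inner (slice_point a I b + w) 1 = a" "im_part (slice_point a I b + w) = b *\<^sub>R I + w"
      using w I q by (simp_all add: im_part_def slice_point_def inner_add_left)
    have vw: "inner (y *\<^sub>R I) (b *\<^sub>R I + w) = y * b"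
      using w q by (simp add: inner_add_right inner_commute)
    have "deriv cos_sqrt (y\<^sup>2) * (2 * (y * b)) = - b * sin y"
      using deriv_cos_sqrt_square[of y] by (simp add: algebra_simps)
    \<comment> \<open>The total coefficient of I, where the factor \<open>y\<close> comes from the
      imaginary part Iy, is regrouped so that the two identities for \<open>sinc_sqrt\<close>
      apply.\<close>
    moreover have "(sinh x * a * sinc_sqrt (y\<^sup>2) +
          cosh x * (deriv sinc_sqrt (y\<^sup>2) * (2 * (y * b)))) * y + cosh x * sinc_sqrt (y\<^sup>2) * b =
        a * sinh x * (sinc_sqrt (y\<^sup>2) * y) +
        b * cosh x * (deriv sinc_sqrt (y\<^sup>2) * (2 * y\<^sup>2) + sinc_sqrt (y\<^sup>2))"
      by (simp add: algebra_simps power2_eq_square)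
    hence "((sinh x * a * sinc_sqrt (y\<^sup>2) +
          cosh x * (deriv sinc_sqrt (y\<^sup>2) * (2 * (y * b)))) * y + cosh x * sinc_sqrt (y\<^sup>2) * b) *\<^sub>R I =
        (a * sinh x * sin y + b * cosh x * cos y) *\<^sub>R I"
      by (simp only: sinc_sqrt_square deriv_sinc_sqrt_square)
    ultimately show ?thesis
      unfolding catenoid_deriv_def Let_def slice_point_coords[OF one I(1)] q h vw cos_sqrt_square
      by (simp add: scaleR_add_left scaleR_add_right algebra_simps)
  qed
  have "inner (catenoid_deriv (slice_point x I y) (slice_point a I b + w))
      (catenoid_deriv (slice_point x I y) (slice_point a' I b' + w')) =
      (a * sinh x * cos y - b * cosh x * sin y) * (a' * sinh x * cos y - b' * cosh x * sin y) +
      (a * sinh x * sin y + b * cosh x * cos y) * (a' * sinh x * sin y + b' * cosh x * cos y) +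
      (cosh x * sinc_sqrt (y\<^sup>2))\<^sup>2 * inner w w' + a * a'"
    unfolding D[OF w] D[OF w']
    using I q w w' by (simp add: inner_add_left inner_add_right inner_commute power2_eq_square)
  \<comment> \<open>The products of \<open>a\<close> with \<open>b'\<close> and of \<open>b\<close>
    with \<open>a'\<close> cancel. The extra \<open>a * a'\<close> from the real component then
    turns the squared sinh into the squared cosh, which gives both chart directions the same
    length.\<close>
  also have "\<dots> = ((sinh x)\<^sup>2 * a * a' + (cosh x)\<^sup>2 * b * b') * ((sin y)\<^sup>2 + (cos y)\<^sup>2) + a * a' +
      (cosh x * sinc_sqrt (y\<^sup>2))\<^sup>2 * inner w w'"
    unfolding power2_eq_square by (simp only: algebra_simps)
  also have "\<dots> = (cosh x)\<^sup>2 * (a * a' + b * b') + (cosh x * sinc_sqrt (y\<^sup>2))\<^sup>2 * inner w w'"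
    unfolding sin_cos_squared_add cosh_square_eq by (simp add: algebra_simps)
  finally show ?thesis .
qed

text \<open>All three claims come from \<open>inner_catenoid_deriv\<close>: with zero orthogonal
  parts, with zero slice parts, and with both arguments equal to a vector of the kernel.\<close>

lemma conformal_catenoid_deriv:
  fixes I :: "'a::{euclidean_space, one}"
  assumes one: "norm (1::'a) = 1" and I: "inner I 1 = 0" "norm I = 1" and y: "\<bar>y\<bar> < pi"
  shows "conformal_on (slice_plane I) (catenoid_deriv (slice_point x I y))" (is ?plane)
    and "conformal_on (orthogonal_comp (slice_plane I)) (catenoid_deriv (slice_point x I y))" (is ?comp)
    and "inj (catenoid_deriv (slice_point x I y))" (is ?inj)
proof -
  let ?D = "catenoid_deriv (slice_point x I y)"
  note inner = inner_catenoid_deriv[OF one I]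
  have lin: "linear ?D"
    by (rule has_derivative_linear[OF has_derivative_catenoid])
  have q: "inner I I = 1" "inner (1::'a) 1 = 1"
    using one I(2) by (simp_all add: norm_eq_1)
  have nz: "cosh x * sinc_sqrt (y\<^sup>2) \<noteq> 0"
    using sinc_sqrt_nonzero[OF y] by simp
  show ?plane
  proof (rule conformal_onI[OF subspace_slice_plane lin, of "(cosh x)\<^sup>2"])
    fix u v
    assume "u \<in> slice_plane I" "v \<in> slice_plane I"
    then obtain a b a' b' where "u = slice_point a I b" "v = slice_point a' I b'"
      unfolding slice_plane_def by blast
    thus "inner (?D u) (?D v) = (cosh x)\<^sup>2 * inner u v"
      using inner[of 0 0 x y a b a' b'] I q
      by (simp add: slice_point_def inner_add_left inner_add_right inner_commute)
  qed simp
  show ?comp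
  proof (rule conformal_onI[OF subspace_orthogonal_comp lin, of "(cosh x * sinc_sqrt (y\<^sup>2))\<^sup>2"])
    fix u v
    assume "u \<in> orthogonal_comp (slice_plane I)" "v \<in> orthogonal_comp (slice_plane I)"
    thus "inner (?D u) (?D v) = (cosh x * sinc_sqrt (y\<^sup>2))\<^sup>2 * inner u v"
      using inner[of u v x y 0 0 0 0] by (simp add: orthogonal_slice_plane slice_point_def)
  qed (use nz in simp)
  have "h = 0" if "?D h = 0" for h
  proof -
    define a b w where "a = inner h 1" "b = inner h I" "w = h - slice_point a I b"
    have h: "h = slice_point a I b + w" and w: "inner w 1 = 0" "inner w I = 0"
      using I q by (simp_all add: a_b_w_def slice_point_def inner_diff_left inner_add_left inner_commute[of 1 I])
    have eq: "(cosh x)\<^sup>2 * (a * a + b * b) + (cosh x * sinc_sqrt (y\<^sup>2))\<^sup>2 * inner w w = 0"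
      using inner[OF w w, of x y a b a b] that by (simp flip: h)
    \<comment> \<open>A sum of two nonnegative terms vanishes only if both do, and neither dilation
      factor is zero.\<close>
    have "(cosh x)\<^sup>2 * (a * a + b * b) \<ge> 0" "(cosh x * sinc_sqrt (y\<^sup>2))\<^sup>2 * inner w w \<ge> 0"
      by simp_all
    hence "(cosh x)\<^sup>2 * (a * a + b * b) = 0" "(cosh x * sinc_sqrt (y\<^sup>2))\<^sup>2 * inner w w = 0"
      using eq by linarith+
    hence "a = 0" "b = 0" "w = 0"
      using nz by (auto simp: sum_squares_eq_zero_iff)
    thus ?thesis
      by (simp add: h slice_point_def)
  qed
  thus ?inj
    using linear_injective_0[OF lin] by blast
qed

text \<open>The last component recovers x. The component along 1 recovers the cosine of the norm of
  the imaginary part, hence that norm, as the cosine is injective between 0 and pi. The imaginary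
  part follows because \<open>sinc_sqrt\<close> does not vanish there.\<close>

lemma inj_on_catenoid:
  assumes one: "norm (1::'a::{euclidean_space, one}) = 1"
  shows "inj_on catenoid {p::'a. norm (im_part p) < pi}"
proof (rule inj_onI)
  fix p p' :: 'a
  assume p: "p \<in> {p. norm (im_part p) < pi}" "p' \<in> {p. norm (im_part p) < pi}"
    and eq: "catenoid p = catenoid p'"
  define v v' where "v = im_part p" "v' = im_part p'"
  have x: "inner p 1 = inner p' 1"
    using eq by (simp add: catenoid_def)
  let ?x = "inner p' 1"
  have fst: "(cosh ?x * cos (norm v)) *\<^sub>R 1 + (cosh ?x * sinc_sqrt ((norm v)\<^sup>2)) *\<^sub>R v =
      (cosh ?x * cos (norm v')) *\<^sub>R 1 + (cosh ?x * sinc_sqrt ((norm v')\<^sup>2)) *\<^sub>R v'"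
    using eq x by (simp add: catenoid_def v_v'_def cos_sqrt_square flip: power2_norm_eq_inner)
  have "inner v 1 = 0" "inner v' 1 = 0" "inner (1::'a) 1 = 1"
    using one by (simp_all add: v_v'_def inner_im_part_one norm_eq_1)
  hence "cosh ?x * cos (norm v) = cosh ?x * cos (norm v')"
    using arg_cong[OF fst, of "\<lambda>u. inner u 1"] by (simp add: inner_add_left)
  hence "cos (norm v) = cos (norm v')"
    by simp
  with p have norm: "norm v = norm v'"
    by (simp add: v_v'_def cos_inj_pi)
  hence "(cosh ?x * sinc_sqrt ((norm v')\<^sup>2)) *\<^sub>R v = (cosh ?x * sinc_sqrt ((norm v')\<^sup>2)) *\<^sub>R v'"
    using fst by simp
  moreover have "sinc_sqrt ((norm v')\<^sup>2) \<noteq> 0"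
    using p by (intro sinc_sqrt_nonzero) (simp add: v_v'_def)
  ultimately have "v = v'"
    by simp
  thus "p = p'"
    using x by (simp add: v_v'_def im_part_def)
qed

section \<open>Transfer to any map given by the formula on the strip\<close>

text \<open>The facts about the algebra enter as hypotheses, so that quaternions and octonions are
  treated together.\<close>

lemma slice_isothermal_catenoid:
  fixes f :: "'a::{euclidean_space, times, one} \<Rightarrow> 'a \<times> real"
  assumes one: "norm (1::'a) = 1"
    and units: "imag_units = {I::'a. inner I 1 = 0 \<and> norm I = 1}"
    and ne: "(imag_units :: 'a set) \<noteq> {}"
    and f: "\<And>x y I. y \<in> {-pi<..<pi} \<Longrightarrow> I \<in> imag_units \<Longrightarrow>
           f (slice_point x I y) = (slice_point (cosh x * cos y) I (cosh x * sin y), x)"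
  shows "slice_isothermal_parameterization (slice_strip UNIV {-pi<..<pi}) f"
proof -
  let ?\<Omega> = "slice_strip UNIV {-pi<..<pi} :: 'a set"
  note strip = slice_strip_eq[OF one units ne, of pi]
  have dom: "slice_domain ?\<Omega>"
    unfolding strip by (rule slice_domain_strip[OF one pi_gt_zero])
  have eq: "f p = catenoid p" if "p \<in> ?\<Omega>" for p
    using that f by (auto simp: slice_strip_def catenoid_slice_point[OF one] units)
  \<comment> \<open>The values of \<open>f\<close> are prescribed on the strip only; since the strip
    is open, agreement with \<open>catenoid\<close> there determines the derivative.\<close>
  have deriv: "(f has_derivative catenoid_deriv p) (at p)" if "p \<in> ?\<Omega>" for p
    by (rule has_derivative_transform_within_open[OF has_derivative_catenoid _ that])
      (use dom eq in \<open>auto simp: slice_domain_def\<close>)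
  have fd: "frechet_derivative f (at p) = catenoid_deriv p" if "p \<in> ?\<Omega>" for p
    using frechet_derivative_at[OF deriv[OF that]] by simp
  have "C1_on ?\<Omega> f"
  proof -
    obtain F where "\<And>p. p \<in> ?\<Omega> \<Longrightarrow> (catenoid has_derivative blinfun_apply (F p)) (at p)"
      "continuous_on ?\<Omega> F"
      using C1_on_catenoid[of ?\<Omega>] unfolding C1_on_def by blast
    moreover from this have "blinfun_apply (F p) = catenoid_deriv p" if "p \<in> ?\<Omega>" for p
      using that has_derivative_catenoid has_derivative_unique by blast
    ultimately show ?thesis
      unfolding C1_on_def using deriv by metis
  qed
  moreover have "conformal_on (slice_plane I) (frechet_derivative f (at (slice_point x I y)))"
    "conformal_on (orthogonal_comp (slice_plane I)) (frechet_derivative f (at (slice_point x I y)))"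
    if "I \<in> imag_units" "slice_point x I y \<in> ?\<Omega>" for x y I
  proof -
    have I: "inner I 1 = 0" "norm I = 1"
      using that(1) by (auto simp: units)
    have "\<bar>y\<bar> < pi"
      using that(2) I by (simp add: strip slice_point_coords[OF one])
    thus "conformal_on (slice_plane I) (frechet_derivative f (at (slice_point x I y)))"
      "conformal_on (orthogonal_comp (slice_plane I)) (frechet_derivative f (at (slice_point x I y)))"
      using conformal_catenoid_deriv[OF one I] by (simp_all add: fd that(2))
  qed
  moreover have "inj (frechet_derivative f (at p))" if p: "p \<in> ?\<Omega>" for p
  proof -
    obtain x y I where "p = slice_point x I y" "\<bar>y\<bar> < pi" "inner I 1 = 0" "norm I = 1"
      using p by (auto simp: slice_strip_def units abs_less_iff)
    thus ?thesis
      using conformal_catenoid_deriv(3)[OF one] fd[OF p] by simp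
  qed
  moreover have "inj_on f ?\<Omega>"
    using inj_on_catenoid[OF one] eq unfolding strip by (simp add: inj_on_def)
  ultimately show ?thesis
    unfolding slice_isothermal_parameterization_def slice_conformal_def using dom by simp
qed

section \<open>The imaginary units of the two algebras and the conclusion\<close>

lemma norm_one_quat: "norm (1::quat) = 1" and norm_one_octo: "norm (1::octo) = 1"
  by (simp_all add: norm_cd_def cd_defs)

text \<open>Every element satisfies a real quadratic equation with its trace and squared norm as
  coefficients; with trace 0 and norm 1 it says that the square is -1.\<close>

lemma imag_units_quat_eq: "imag_units = {I::quat. inner I 1 = 0 \<and> norm I = 1}"
proof -
  have sq: "I * I = (2 * inner I 1) *\<^sub>R I - (norm I)\<^sup>2 *\<^sub>R 1" for I :: quat
    by (cases I) (simp add: power2_norm_eq_inner cd_defs inner_complex_def complex_eq_iff algebra_simps)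
  have "I \<in> imag_units" if "inner I 1 = 0" "norm I = 1" for I :: quat
    unfolding imag_units_def using sq[of I] by (simp add: that)
  thus ?thesis
    using imag_units_quat by blast
qed

lemma imag_units_octo_eq: "imag_units = {I::octo. inner I 1 = 0 \<and> norm I = 1}"
proof -
  have sq: "I * I = (2 * inner I 1) *\<^sub>R I - (norm I)\<^sup>2 *\<^sub>R 1" for I :: octo
    by (cases I) (simp add: power2_norm_eq_inner cd_defs inner_complex_def complex_eq_iff algebra_simps)
  have "I \<in> imag_units" if "inner I 1 = 0" "norm I = 1" for I :: octo
    unfolding imag_units_def using sq[of I] by (simp add: that)
  thus ?thesis
    using imag_units_octo by blast
qed

lemma imag_units_quat_nonempty: "(imag_units :: quat set) \<noteq> {}"
proof -
  \<comment> \<open>The element adjoined by the Cayley--Dickson doubling squares to -1.\<close>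
  have "CD 0 1 \<in> (imag_units :: quat set)"
    by (simp add: imag_units_def cd_defs)
  thus ?thesis by blast
qed

lemma imag_units_octo_nonempty: "(imag_units :: octo set) \<noteq> {}"
proof -
  have "CD 0 1 \<in> (imag_units :: octo set)"
    by (simp add: imag_units_def cd_defs)
  thus ?thesis by blast
qed

theorem proposition4p4:
  shows
    "(\<forall>f :: quat \<Rightarrow> quat \<times> real.
        (\<forall>x. \<forall>y\<in>{-pi<..<pi}. \<forall>I\<in>imag_units.
           f (slice_point x I y) = (slice_point (cosh x * cos y) I (cosh x * sin y), x)) \<longrightarrow>
        parameterized_hypercomplex_manifold TYPE(quat) (f ` slice_strip UNIV {-pi<..<pi}) \<and>
        slice_isothermal_parameterization (slice_strip UNIV {-pi<..<pi}) f) \<and>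
     (\<forall>f :: octo \<Rightarrow> octo \<times> real.
        (\<forall>x. \<forall>y\<in>{-pi<..<pi}. \<forall>I\<in>imag_units.
           f (slice_point x I y) = (slice_point (cosh x * cos y) I (cosh x * sin y), x)) \<longrightarrow>
        parameterized_hypercomplex_manifold TYPE(octo) (f ` slice_strip UNIV {-pi<..<pi}) \<and>
        slice_isothermal_parameterization (slice_strip UNIV {-pi<..<pi}) f)"
proof (rule conjI; intro allI impI)
  fix f :: "quat \<Rightarrow> quat \<times> real"
  assume "\<forall>x. \<forall>y\<in>{-pi<..<pi}. \<forall>I\<in>imag_units.
    f (slice_point x I y) = (slice_point (cosh x * cos y) I (cosh x * sin y), x)"
  hence "slice_isothermal_parameterization (slice_strip UNIV {-pi<..<pi}) f"
    by (intro slice_isothermal_catenoid norm_one_quat imag_units_quat_eq imag_units_quat_nonempty) blast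
  thus "parameterized_hypercomplex_manifold TYPE(quat) (f ` slice_strip UNIV {-pi<..<pi}) \<and>
      slice_isothermal_parameterization (slice_strip UNIV {-pi<..<pi}) f"
    unfolding parameterized_hypercomplex_manifold_def by blast
next
  fix f :: "octo \<Rightarrow> octo \<times> real"
  assume "\<forall>x. \<forall>y\<in>{-pi<..<pi}. \<forall>I\<in>imag_units.
    f (slice_point x I y) = (slice_point (cosh x * cos y) I (cosh x * sin y), x)"
  hence "slice_isothermal_parameterization (slice_strip UNIV {-pi<..<pi}) f"
    by (intro slice_isothermal_catenoid norm_one_octo imag_units_octo_eq imag_units_octo_nonempty) blast
  thus "parameterized_hypercomplex_manifold TYPE(octo) (f ` slice_strip UNIV {-pi<..<pi}) \<and>
      slice_isothermal_parameterization (slice_strip UNIV {-pi<..<pi}) f"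
    unfolding parameterized_hypercomplex_manifold_def by blast
qed

end
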